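(* Let $L\subseteq\{0,1\}^*$ be a 0-1-symmetric language. Then $\mathcal{G}_L$ is closed under adding some twins: for every $G=(V,E)\in\mathcal{G}_L$, every $v\in V$ and every new vertex $v'\notin V$, at least one of the following holds: (i) the graph obtained from $G$ by adding $v'$ as a true twin of $v$ (i.e., $v'$ adjacent to $v$ and to exactly the neighbors of $v$) belongs to $\mathcal{G}_L$; (ii) the graph obtained from $G$ by adding $v'$ as a false twin of $v$ (i.e., $v'$ adjacent to exactly the neighbors of $v$ but not to $v$) belongs to $\mathcal{G}_L$.
   Context: All graphs are finite, simple, undirected, with nonempty vertex sets, and graph classes are considered up to isomorphism. For $w\in\{0,1\}^*$ let $\widetilde{w}$ be obtained from $w$ by exchanging the letters 0 and 1; a language $L\subseteq\{0,1\}^*$ is 0-1-symmetric if $L=\{\widetilde w : w\in L\}$. For an alphabet $V$ and distinct $u,v\in V$, $h_{u,v}:V^*\to\{0,1\}^*$ is the monoid morphism with $u\mapsto 0$, $v\mapsto 1$ and $x\mapsto\lambda$ (empty word) for all other letters $x$. For a 0-1-symmetric $L$ and a nonempty word $w$ whose set of occurring letters is $V$, $G(L,w)$ is the graph with vertex set $V$ in which distinct $u,v$ are adjacent iff $h_{u,v}(w)\in L$. A graph is $L$-representable if it is isomorphic to some $G(L,w)$, and $\mathcal{G}_L$ denotes the class of all $L$-representable graphs. *)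

theory Defs
  imports "Graph_Theory.Pair_Digraph" "Graph_Theory.Digraph_Isomorphism"
begin

text \<open>
  Graphs are \<^locale>\<open>pair_graph\<close>s: finite vertex set, and a symmetric, irreflexive
  arc relation on it. Binary words are lists of Booleans, with False for the letter 0 and
  True for the letter 1.
\<close>

definition swap01 :: "bool list \<Rightarrow> bool list" where
  "swap01 w = map Not w"

definition zero_one_symmetric :: "bool list set \<Rightarrow> bool" where
  "zero_one_symmetric L \<longleftrightarrow> L = swap01 ` L"

text \<open>Only meaningful for distinct \<open>u\<close> and \<open>v\<close>.\<close>

definition proj01 :: "'a \<Rightarrow> 'a \<Rightarrow> 'a list \<Rightarrow> bool list" where
  "proj01 u v w = concat (map (\<lambda>x. if x = u then [False] else if x = v then [True] else []) w)"

definition word_graph :: "bool list set \<Rightarrow> 'a list \<Rightarrow> 'a pair_pre_digraph" where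
  "word_graph L w =
     \<lparr> pverts = set w,
       parcs = {(u, v). u \<in> set w \<and> v \<in> set w \<and> u \<noteq> v \<and> proj01 u v w \<in> L} \<rparr>"

text \<open>
  The representing word is taken over the countably infinite alphabet \<^typ>\<open>nat\<close>, since
  HOL does not quantify over types inside a formula. By \<open>word_graph_in_representable_graphs\<close>
  below, words over any other alphabet yield no further graphs.
\<close>

definition representable :: "bool list set \<Rightarrow> 'a pair_pre_digraph \<Rightarrow> bool" where
  "representable L G \<longleftrightarrow>
     (\<exists>w :: nat list. w \<noteq> [] \<and> digraph_iso (with_proj (word_graph L w)) (with_proj G))"

definition representable_graphs :: "bool list set \<Rightarrow> 'a pair_pre_digraph set" where
  "representable_graphs L = {G. pair_graph G \<and> pverts G \<noteq> {} \<and> representable L G}"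

definition add_false_twin :: "'a pair_pre_digraph \<Rightarrow> 'a \<Rightarrow> 'a \<Rightarrow> 'a pair_pre_digraph" where
  "add_false_twin G v v' =
     \<lparr> pverts = insert v' (pverts G),
       parcs = parcs G \<union> {(v', u) | u. (v, u) \<in> parcs G} \<union> {(u, v') | u. (u, v) \<in> parcs G} \<rparr>"

definition add_true_twin :: "'a pair_pre_digraph \<Rightarrow> 'a \<Rightarrow> 'a \<Rightarrow> 'a pair_pre_digraph" where
  "add_true_twin G v v' =
     \<lparr> pverts = insert v' (pverts G),
       parcs = parcs G \<union> {(v', u) | u. (v, u) \<in> parcs G} \<union> {(u, v') | u. (u, v) \<in> parcs G}
                 \<union> {(v, v'), (v', v)} \<rparr>"

lemma swap01_proj01: "u \<noteq> v \<Longrightarrow> swap01 (proj01 u v w) = proj01 v u w"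
  by (induction w) (auto simp: swap01_def proj01_def)

lemma proj01_in_commute:
  assumes "zero_one_symmetric L" "u \<noteq> v"
  shows "proj01 u v w \<in> L \<longleftrightarrow> proj01 v u w \<in> L"
  using assms swap01_proj01 unfolding zero_one_symmetric_def by (metis imageI)

lemma pair_graph_word_graph:
  assumes "zero_one_symmetric L"
  shows "pair_graph (word_graph L w)"
proof
  show "finite (parcs (word_graph L w))"
    by (rule finite_subset[of _ "set w \<times> set w"]) (auto simp: word_graph_def)
  show "symmetric (with_proj (word_graph L w))"
    unfolding symmetric_def with_proj_simps
    by (rule symI) (auto simp: word_graph_def proj01_in_commute[OF assms, THEN iffD1])
qed (auto simp: word_graph_def)

lemma proj01_map:
  assumes "inj_on f (insert u (insert v (set w)))"
  shows "proj01 (f u) (f v) (map f w) = proj01 u v w"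
  using assms by (induction w) (auto simp: proj01_def inj_on_def)

lemma word_graph_in_representable_graphs:
  fixes w :: "'a list"
  assumes L: "zero_one_symmetric L" and w: "w \<noteq> []"
  shows "word_graph L w \<in> representable_graphs L"
proof -
  obtain f :: "'a \<Rightarrow> nat" where f: "inj_on f (set w)"
    using finite_imp_inj_to_nat_seg[of "set w"] by auto
  define g where "g = the_inv_into (set w) f"
  have gf: "g (f x) = x" if "x \<in> set w" for x
    using f that by (simp add: g_def the_inv_into_f_f)
  let ?w = "map f w"
  let ?iso = "\<lparr> iso_verts = g, iso_arcs = map_prod g g, iso_head = snd, iso_tail = fst \<rparr>"
  interpret G: pair_graph "word_graph L ?w" by (rule pair_graph_word_graph[OF L])
  have g: "inj_on g (set ?w)" using gf by (auto simp: inj_on_def)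
  have sub: "parcs (word_graph L ?w) \<subseteq> set ?w \<times> set ?w" by (auto simp: word_graph_def)
  have "inj_on (map_prod g g) (parcs (word_graph L ?w))"
    by (rule inj_on_subset[OF map_prod_inj_on[OF g g] sub])
  then have "pre_digraph.digraph_isomorphism (with_proj (word_graph L ?w)) ?iso"
    using g G.wf_digraph by (auto simp: pre_digraph.digraph_isomorphism_def word_graph_def)
  moreover have arcs: "map_prod g g ` parcs (word_graph L ?w) = parcs (word_graph L w)"
  proof -
    have p: "proj01 (f u) (f v) ?w = proj01 u v w" if "u \<in> set w" "v \<in> set w" for u v
      using that f by (intro proj01_map) (simp add: insert_absorb)
    have ne: "f u \<noteq> f v \<longleftrightarrow> u \<noteq> v" if "u \<in> set w" "v \<in> set w" for u v
      using that f by (auto simp: inj_on_def)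
    have "parcs (word_graph L ?w) = map_prod f f ` parcs (word_graph L w)"
      using p ne by (auto simp: word_graph_def image_iff Bex_def)
    moreover have "map_prod g g ` map_prod f f ` parcs (word_graph L w) = parcs (word_graph L w)"
      using gf unfolding image_image
      by (subst image_cong[OF refl, where g = "\<lambda>x. x"]) (auto simp: word_graph_def)
    ultimately show ?thesis by simp
  qed
  have "with_proj (word_graph L w) = app_iso ?iso (with_proj (word_graph L ?w))"
  proof -
    have "g ` f ` set w = set w" using gf by force
    then show ?thesis using arcs by (simp add: app_iso_def with_proj_def word_graph_def)
  qed
  ultimately have "digraph_iso (with_proj (word_graph L ?w)) (with_proj (word_graph L w))"
    unfolding digraph_iso_def by blast
  then have "representable L (word_graph L w)"
    unfolding representable_def using w by blast
  then show ?thesis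
    using pair_graph_word_graph[OF L] w
    by (simp add: representable_graphs_def) (simp add: word_graph_def)
qed

end

(* Once the representing word is renamed to a word over the vertices of the graph, replace every
   occurrence of v by v v'. Then v' sees every letter other than v exactly as v does, and whether
   the twin is true or false is decided by whether (01)^n is in L, where n is the number of
   occurrences of v. *)
theory Submission
  imports Defs
begin

text \<open>The vertex map of the isomorphism is injective on the letters, so renaming the word
  along it preserves all projections. Twins can then be treated by equality of graphs instead of
  isomorphism.\<close>

lemma representable_imp_word_graph:
  fixes G :: "'a pair_pre_digraph"
  assumes L: "zero_one_symmetric L" and G: "G \<in> representable_graphs L"
  obtains w :: "'a list" where "w \<noteq> []" "word_graph L w = G"
proof -
  obtain w :: "nat list" and h where "w \<noteq> []"
    and iso: "pre_digraph.digraph_isomorphism (with_proj (word_graph L w)) h"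
    and app: "with_proj G = app_iso h (with_proj (word_graph L w))"
    using G unfolding representable_graphs_def representable_def digraph_iso_def by blast
  define f where "f = iso_verts h"
  have inj: "inj_on f (set w)"
    using iso by (simp add: pre_digraph.digraph_isomorphism_def word_graph_def f_def)
  \<comment> \<open>\<open>app_iso\<close> installs \<open>iso_tail h\<close> and
    \<open>iso_head h\<close> as the incidence maps of the image, and those of
    \<open>with_proj G\<close> are the projections.\<close>
  have tail: "iso_tail h = fst" and head: "iso_head h = snd"
    using arg_cong[OF app, of tail] arg_cong[OF app, of head] by (simp_all add: app_iso_def)
  have verts: "pverts G = f ` set w"
    using arg_cong[OF app, of verts] by (simp add: f_def app_iso_def word_graph_def)
  \<comment> \<open>An isomorphism commutes with tail and head; as these are the two projections,
    the vertex map alone determines the image of an arc.\<close>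
  have "iso_arcs h a = map_prod f f a" if "a \<in> parcs (word_graph L w)" for a
    using iso that by (auto simp: pre_digraph.digraph_isomorphism_def f_def tail head prod_eq_iff)
  then have arcs: "parcs G = map_prod f f ` parcs (word_graph L w)"
    using arg_cong[OF app, of arcs] by (simp add: app_iso_def)
  have p: "proj01 (f u) (f v) (map f w) = proj01 u v w" if "u \<in> set w" "v \<in> set w" for u v
    using that inj by (intro proj01_map) (simp add: insert_absorb)
  have ne: "f u \<noteq> f v \<longleftrightarrow> u \<noteq> v" if "u \<in> set w" "v \<in> set w" for u v
    using that inj by (auto simp: inj_on_def)
  have "parcs (word_graph L (map f w)) = map_prod f f ` parcs (word_graph L w)"
    using p ne by (auto simp: word_graph_def image_iff Bex_def)
  with verts arcs have "word_graph L (map f w) = G"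
    by (intro pair_pre_digraph.equality) (simp_all add: word_graph_def)
  with \<open>w \<noteq> []\<close> show thesis by (intro that[of "map f w"]) auto
qed

definition double_letter :: "'a \<Rightarrow> 'a \<Rightarrow> 'a list \<Rightarrow> 'a list" where
  "double_letter v v' w = concat (map (\<lambda>x. if x = v then [v, v'] else [x]) w)"

lemma set_double_letter: "v \<in> set w \<Longrightarrow> set (double_letter v v' w) = insert v' (set w)"
  by (auto simp: double_letter_def split: if_splits)

text \<open>The projection erases every inserted \<open>v'\<close>. The case that \<open>u\<close>
  or \<open>x\<close> equals \<open>v\<close> is included.\<close>

lemma proj01_double_letter:
  "u \<noteq> v' \<Longrightarrow> x \<noteq> v' \<Longrightarrow> proj01 u x (double_letter v v' w) = proj01 u x w"
  by (induction w) (auto simp: double_letter_def proj01_def)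

text \<open>Since \<open>v'\<close> is new, it occurs only right after a \<open>v\<close>; erasing
  \<open>v\<close> therefore leaves \<open>w\<close> with \<open>v\<close> renamed to
  \<open>v'\<close>.\<close>

lemma proj01_double_letter_new_left:
  assumes "v' \<notin> set w" "x \<noteq> v" "x \<noteq> v'" "v \<noteq> v'"
  shows "proj01 v' x (double_letter v v' w) = proj01 v x w"
  using assms by (induction w) (auto simp: double_letter_def proj01_def)

lemma proj01_double_letter_new_right:
  assumes "v' \<notin> set w" "x \<noteq> v" "x \<noteq> v'" "v \<noteq> v'"
  shows "proj01 x v' (double_letter v v' w) = proj01 x v w"
  using assms by (induction w) (auto simp: double_letter_def proj01_def)

lemma word_graph_double_letter:
  assumes L: "zero_one_symmetric L" and v: "v \<in> set w" and v': "v' \<notin> set w"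
  shows "word_graph L (double_letter v v' w) =
    (if proj01 v v' (double_letter v v' w) \<in> L then add_true_twin (word_graph L w) v v'
     else add_false_twin (word_graph L w) v v')"
    (is "word_graph L ?w = (if ?c then ?T else ?F)")
proof -
  have "v \<noteq> v'" using v v' by auto
  \<comment> \<open>The arcs between \<open>v\<close> and \<open>v'\<close> must appear in both
    directions or in neither; this is where the symmetry of \<open>L\<close> enters.\<close>
  have sym: "proj01 v' v ?w \<in> L \<longleftrightarrow> ?c"
    using proj01_in_commute[OF L] \<open>v \<noteq> v'\<close> by metis
  have "(a, b) \<in> parcs (word_graph L ?w) \<longleftrightarrow> (a, b) \<in> parcs (if ?c then ?T else ?F)" for a b
    using v v' \<open>v \<noteq> v'\<close> sym
    by (cases "a = v'"; cases "b = v'"; cases "a = v"; cases "b = v")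
      (auto simp: word_graph_def add_true_twin_def add_false_twin_def set_double_letter
        proj01_double_letter proj01_double_letter_new_left proj01_double_letter_new_right)
  then have "parcs (word_graph L ?w) = parcs (if ?c then ?T else ?F)" by auto
  moreover have "pverts (word_graph L ?w) = pverts (if ?c then ?T else ?F)"
    using v by (simp add: word_graph_def add_true_twin_def add_false_twin_def set_double_letter)
  ultimately show ?thesis by (intro pair_pre_digraph.equality) simp_all
qed

theorem mainTheorem2:
  fixes L :: "bool list set" and G :: "'a pair_pre_digraph" and v v' :: 'a
  assumes "zero_one_symmetric L"
    and "G \<in> representable_graphs L"
    and "v \<in> pverts G"
    and "v' \<notin> pverts G"
  shows "add_true_twin G v v' \<in> representable_graphs L \<or>
         add_false_twin G v v' \<in> representable_graphs L"
proof -
  obtain w :: "'a list" where G: "word_graph L w = G"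
    using representable_imp_word_graph[OF assms(1,2)] by blast
  with assms(3,4) have v: "v \<in> set w" "v' \<notin> set w" by (auto simp: word_graph_def)
  then have "double_letter v v' w \<noteq> []"
    using set_double_letter[of v w v'] by auto
  \<comment> \<open>The doubled word is over \<open>'a\<close>, while \<open>representable\<close>
    asks for a word over \<open>nat\<close>; this lemma renames it back.\<close>
  from word_graph_in_representable_graphs[OF assms(1) this]
  show ?thesis
    using word_graph_double_letter[OF assms(1) v] G by (auto split: if_splits)
qed

end
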